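(* Let $f\not\equiv 0$ be a real analytic function on a closed bounded interval $[a,b]$, and let $\{\psi_i\}_{i=0}^{n}$ be a Generalized Budan-Fourier sequence associated to $f$ on $[a,b]$ with associated sequence of pivots $\{\varrho_i\}_{i=1}^{n}$, where no $\varrho_i$ is identically zero. Then: (1) $\psi_{n-1}$ is a constant multiple of $\varrho_n$. (2) For every $k\in\{1,\dots,n\}$, let $G_k$ be the set of all points of $(a,b)$ that are poles of $\psi_k$, sign-changing zeros of $\psi_k$, zeros of $\varrho_k$, or poles of $\varrho_k$. Then $G_k$ is a simple grid for $\psi_{k-1}$ on $[a,b]$: on each of the open intervals into which $G_k$ divides $(a,b)$, the function $\psi_{k-1}/\varrho_k$ is monotonic, and $\psi_{k-1}$ has no poles and at most one sign-changing zero.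
   Context: $D$ denotes differentiation with respect to $x$. Generalized Budan-Fourier (GBF) sequence: a sequence of functions $\{\psi_i,\ i=0,\dots,n\}$ is a GBF sequence associated to the real analytic function $f$ on $[a,b]$, with associated sequence of pivots $\{\varrho_i,\ i=1,\dots,n\}$, if (i) $\psi_0=f$; (ii) $\psi_i$ and $\varrho_i$ are quotients of real analytic functions on $[a,b]$ for each $i=1,\dots,n$; (iii) $\psi_n$ is the zero function; (iv) for each $k=1,\dots,n$, $D\left(\frac{\psi_{k-1}}{\varrho_k}\right)=\frac{\psi_k}{\varrho_k}$ for every $x$ for which both sides are defined. Quotients of real analytic functions are regarded as meromorphic functions (removable singularities are removed). A sign-changing zero of a function $g$ is a point $x_0$ with $g(x_0)=0$ for which there is $\epsilon>0$ such that $g(y)\,g(z)<0$ for all $y,z\in(x_0-\epsilon,x_0+\epsilon)$ with $y<x_0<z$. An open interval is simple for $g$ if it contains at most one sign-changing zero of $g$. A simple grid for $g$ on $[a,b]$ is a finite (possibly empty) sequence of points $x_1<\dots<x_m$ such that $(a,x_1)$, $(x_m,b)$ and all $(x_i,x_{i+1})$, $i=1,\dots,m-1$, are simple intervals for $g$ (if the sequence is empty, $(a,b)$ itself is required to be simple). "Monotonic" is in the non-strict sense. *)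

theory Defs
  imports "HOL-Complex_Analysis.Complex_Analysis"
begin

definition real_analytic_on :: "(real \<Rightarrow> real) \<Rightarrow> real set \<Rightarrow> bool"
    (infixl \<open>(real'_analytic'_on)\<close> 50) where
  "f real_analytic_on S \<longleftrightarrow>
     (\<forall>x\<in>S. \<exists>e>0. \<exists>c :: nat \<Rightarrow> real.
        \<forall>y\<in>S. \<bar>y - x\<bar> < e \<longrightarrow> (\<lambda>n. c n * (y - x) ^ n) sums f y)"

(* Real counterpart of remove_sings, relative to S so that end points of an interval are
   treated by one-sided limits: removable singularities are removed and poles get the value 0. *)
definition fill_sings :: "real set \<Rightarrow> (real \<Rightarrow> real) \<Rightarrow> real \<Rightarrow> real" where
  "fill_sings S f x =
     (if \<exists>c. (f \<longlongrightarrow> c) (at x within S) then Lim (at x within S) f else 0)"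

(* The function f / g read meromorphically on S. *)
definition mero_quotient :: "real set \<Rightarrow> (real \<Rightarrow> real) \<Rightarrow> (real \<Rightarrow> real) \<Rightarrow> real \<Rightarrow> real" where
  "mero_quotient S f g = fill_sings S (\<lambda>x. f x / g x)"

(* Compare nicely_meromorphic_on: the value at a removable singularity is the limit, and the
   value at a pole is 0 by convention. *)
definition analytic_quotient_on :: "(real \<Rightarrow> real) \<Rightarrow> real \<Rightarrow> real \<Rightarrow> bool" where
  "analytic_quotient_on h a b \<longleftrightarrow>
     (\<exists>p q. p real_analytic_on {a..b} \<and> q real_analytic_on {a..b} \<and>
        (\<exists>x\<in>{a..b}. q x \<noteq> 0) \<and>
        (\<forall>x\<in>{a..b}. h x = mero_quotient {a..b} p q x))"

(* is_pole relative to S; needed at the end points of an interval, and equivalent to is_pole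
   at interior points of S. *)
definition pole_within :: "(real \<Rightarrow> real) \<Rightarrow> real \<Rightarrow> real set \<Rightarrow> bool" where
  "pole_within f x S \<longleftrightarrow> filterlim f at_infinity (at x within S)"

(* A meromorphic quotient is defined at x iff x is not one of its poles; at a or b the
   derivative is one-sided. *)
definition GBF_sequence ::
    "(real \<Rightarrow> real) \<Rightarrow> real \<Rightarrow> real \<Rightarrow> nat \<Rightarrow> (nat \<Rightarrow> real \<Rightarrow> real) \<Rightarrow> (nat \<Rightarrow> real \<Rightarrow> real) \<Rightarrow> bool" where
  "GBF_sequence f a b n \<psi> \<rho> \<longleftrightarrow>
     (\<forall>x\<in>{a..b}. \<psi> 0 x = f x) \<and>
     (\<forall>i\<in>{1..n}. analytic_quotient_on (\<psi> i) a b \<and> analytic_quotient_on (\<rho> i) a b) \<and>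
     (\<forall>x\<in>{a..b}. \<psi> n x = 0) \<and>
     (\<forall>k\<in>{1..n}. \<forall>x\<in>{a..b}.
        \<not> pole_within (mero_quotient {a..b} (\<psi> (k - 1)) (\<rho> k)) x {a..b} \<longrightarrow>
        \<not> pole_within (mero_quotient {a..b} (\<psi> k) (\<rho> k)) x {a..b} \<longrightarrow>
        (mero_quotient {a..b} (\<psi> (k - 1)) (\<rho> k) has_real_derivative
           mero_quotient {a..b} (\<psi> k) (\<rho> k) x) (at x within {a..b}))"

(* Poles carry the conventional value 0, so they have to be excluded explicitly. *)
definition sign_changing_zero :: "(real \<Rightarrow> real) \<Rightarrow> real \<Rightarrow> bool" where
  "sign_changing_zero g x0 \<longleftrightarrow>
     \<not> is_pole g x0 \<and> g x0 = 0 \<and>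
     (\<exists>\<epsilon>>0. \<forall>y\<in>{x0 - \<epsilon><..<x0 + \<epsilon>}. \<forall>z\<in>{x0 - \<epsilon><..<x0 + \<epsilon>}.
        y < x0 \<and> x0 < z \<longrightarrow> g y * g z < 0)"

definition simple_interval :: "(real \<Rightarrow> real) \<Rightarrow> real set \<Rightarrow> bool" where
  "simple_interval g I \<longleftrightarrow> (\<exists>\<^sub>\<le>\<^sub>1 x. x \<in> I \<and> sign_changing_zero g x)"

definition grid_intervals :: "real \<Rightarrow> real \<Rightarrow> real list \<Rightarrow> real set set" where
  "grid_intervals a b xs =
     (let p = a # xs @ [b] in {{p ! i <..< p ! Suc i} | i. i \<le> length xs})"

definition simple_grid :: "(real \<Rightarrow> real) \<Rightarrow> real \<Rightarrow> real \<Rightarrow> real list \<Rightarrow> bool" where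
  "simple_grid g a b xs \<longleftrightarrow>
     sorted_wrt (<) xs \<and> set xs \<subseteq> {a..b} \<and> (\<forall>I\<in>grid_intervals a b xs. simple_interval g I)"

definition GBF_grid :: "real \<Rightarrow> real \<Rightarrow> (real \<Rightarrow> real) \<Rightarrow> (real \<Rightarrow> real) \<Rightarrow> real set" where
  "GBF_grid a b \<psi>k \<rho>k =
     {x\<in>{a<..<b}. is_pole \<psi>k x \<or> sign_changing_zero \<psi>k x \<or> \<rho>k x = 0 \<or> is_pole \<rho>k x}"

end

(*
  A quotient of real analytic functions is, near each point x, either identically zero or
  asymptotic to c * (y - x)^k with c nonzero, so its zeros and poles are isolated. Put
  h = psi_{k-1} / rho_k and g = psi_k / rho_k, so that h' = g off the poles. A function with a pole
  has an unbounded derivative there, so h has no pole where g has none. On an interval free of grid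
  points rho_k is regular and nonzero and g is regular without sign changes; hence g has constant
  sign and h is monotone. Two sign-changing zeros of psi_{k-1} = h * rho_k would force it to vanish
  between them. For k = n the derivative g is zero and h is constant on all of [a,b].
*)

theory Submission
  imports Defs
begin

section \<open>Real functions of finite order\<close>

text \<open>Quotients are filled in by limits, take the value 0 at poles, and have only one-sided
  limits at \<open>a\<close> and \<open>b\<close>. Local statements are therefore made along
  \<open>at x within S\<close>, and expansions are replaced by a weaker datum: an integer order
  \<open>k\<close> with a nonzero limit of \<open>h y / (y - x) powi k\<close>. Orders subtract
  under division, and an order still tells whether the function vanishes nearby, whether it has a
  pole, and, by its parity, whether its sign changes. Having an order is also what makes the passage
  from "no sign-changing zero" to "constant sign" valid. A continuous function that is negative,
  then zero on a whole interval, then positive has no sign-changing zero in the sense used here;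
  such behaviour is excluded because vanishing near one point forces vanishing on all of
  \<open>S\<close>. Zeros of even order may remain, so the signs obtained are only weak.\<close>

definition finite_order_within :: "(real \<Rightarrow> real) \<Rightarrow> real \<Rightarrow> real set \<Rightarrow> bool" where
  "finite_order_within h x S \<longleftrightarrow>
     (\<forall>\<^sub>F y in at x within S. h y = 0) \<or>
     (\<exists>k. \<exists>c. c \<noteq> 0 \<and> ((\<lambda>y. h y / (y - x) powi k) \<longlongrightarrow> c) (at x within S))"

text \<open>The value 0 at a pole matches the convention built into \<^const>\<open>fill_sings\<close>.\<close>

definition nicely_mero_within :: "(real \<Rightarrow> real) \<Rightarrow> real \<Rightarrow> real set \<Rightarrow> bool" where
  "nicely_mero_within h x S \<longleftrightarrow>
     finite_order_within h x S \<and>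
     ((h \<longlongrightarrow> h x) (at x within S) \<or> pole_within h x S \<and> h x = 0)"

text \<open>A punctured neighbourhood of \<open>x\<close> is open (relative to \<open>S\<close>), so
  it is also a neighbourhood of each of its points. This carries local information from a point to
  its neighbours in all local constancy arguments below.\<close>

lemma eventually_nested_within:
  assumes "\<forall>\<^sub>F y in at (x::real) within S. P y"
  shows "\<forall>\<^sub>F y in at x within S. \<forall>\<^sub>F z in at y within S. P z"
proof -
  obtain U where U: "open U" "x \<in> U" "\<And>y. y \<in> U \<Longrightarrow> y \<noteq> x \<Longrightarrow> y \<in> S \<Longrightarrow> P y"
    using assms unfolding eventually_at_topological by blast
  have "\<forall>\<^sub>F z in at y within S. P z" if "y \<in> U" "y \<noteq> x" for y
    unfolding eventually_at_topological
    by (rule exI[of _ "U - {x}"]) (use U that in auto)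
  thus ?thesis
    using U(1,2) unfolding eventually_at_topological by blast
qed

lemma eventually_at_within_ne: "\<forall>\<^sub>F y in at (x::real) within S. y \<noteq> x"
  by (simp add: eventually_at_filter)

lemma eventually_at_within_mem: "\<forall>\<^sub>F y in at (x::real) within S. y \<in> S"
  by (simp add: eventually_at_filter)

lemma finite_order_within_cong:
  assumes "\<forall>\<^sub>F y in at x within S. g y = h y" and "finite_order_within g x S"
  shows "finite_order_within h x S"
  using assms(2) unfolding finite_order_within_def
proof (elim disjE exE conjE)
  assume "\<forall>\<^sub>F y in at x within S. g y = 0"
  hence "\<forall>\<^sub>F y in at x within S. h y = 0"
    using assms(1) by eventually_elim auto
  thus "(\<forall>\<^sub>F y in at x within S. h y = 0) \<or>
     (\<exists>k. \<exists>c. c \<noteq> 0 \<and> ((\<lambda>y. h y / (y - x) powi k) \<longlongrightarrow> c) (at x within S))" ..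
next
  fix k c assume c: "c \<noteq> 0" and lim: "((\<lambda>y. g y / (y - x) powi k) \<longlongrightarrow> c) (at x within S)"
  have "((\<lambda>y. h y / (y - x) powi k) \<longlongrightarrow> c) (at x within S)"
    by (rule Lim_transform_eventually[OF lim]) (use assms(1) in eventually_elim, simp)
  thus "(\<forall>\<^sub>F y in at x within S. h y = 0) \<or>
     (\<exists>k. \<exists>c. c \<noteq> 0 \<and> ((\<lambda>y. h y / (y - x) powi k) \<longlongrightarrow> c) (at x within S))"
    using c by blast
qed

lemma finite_order_within_divide:
  assumes "finite_order_within g x S" "finite_order_within h x S"
  shows "finite_order_within (\<lambda>y. g y / h y) x S"
proof (cases "(\<forall>\<^sub>F y in at x within S. g y = 0) \<or> (\<forall>\<^sub>F y in at x within S. h y = 0)")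
  case True
  \<comment> \<open>A denominator vanishing near \<open>x\<close> is covered as well, since division
    by zero yields 0.\<close>
  hence "\<forall>\<^sub>F y in at x within S. g y / h y = 0"
    by (auto elim: eventually_mono)
  thus ?thesis unfolding finite_order_within_def ..
next
  case False
  then obtain k c l d where c: "c \<noteq> 0" "((\<lambda>y. g y / (y - x) powi k) \<longlongrightarrow> c) (at x within S)"
    and d: "d \<noteq> 0" "((\<lambda>y. h y / (y - x) powi l) \<longlongrightarrow> d) (at x within S)"
    using assms unfolding finite_order_within_def by blast
  have "((\<lambda>y. (g y / (y - x) powi k) / (h y / (y - x) powi l)) \<longlongrightarrow> c / d) (at x within S)"
    using c d by (intro tendsto_divide) auto
  moreover have "\<forall>\<^sub>F y in at x within S. (g y / (y - x) powi k) / (h y / (y - x) powi l) =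
      (g y / h y) / (y - x) powi (k - l)"
    using eventually_at_within_ne by eventually_elim (simp add: power_int_diff)
  ultimately have "((\<lambda>y. (g y / h y) / (y - x) powi (k - l)) \<longlongrightarrow> c / d) (at x within S)"
    by (rule Lim_transform_eventually)
  thus ?thesis using c(1) d(1) unfolding finite_order_within_def by (metis divide_eq_0_iff)
qed

lemma finite_order_within_zero_or_nonzero:
  assumes "finite_order_within h x S"
  shows "(\<forall>\<^sub>F y in at x within S. h y = 0) \<or> (\<forall>\<^sub>F y in at x within S. h y \<noteq> 0)"
proof (cases "\<forall>\<^sub>F y in at x within S. h y = 0")
  case False
  then obtain k c where c: "c \<noteq> 0" "((\<lambda>y. h y / (y - x) powi k) \<longlongrightarrow> c) (at x within S)"
    using assms unfolding finite_order_within_def by blast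
  have "\<forall>\<^sub>F y in at x within S. h y / (y - x) powi k \<noteq> 0"
    using tendsto_imp_eventually_ne[OF c(2,1)] .
  hence "\<forall>\<^sub>F y in at x within S. h y \<noteq> 0"
    by eventually_elim auto
  thus ?thesis ..
qed auto

lemma finite_order_within_tendsto_or_pole:
  assumes "finite_order_within h x S"
  shows "(\<exists>l. (h \<longlongrightarrow> l) (at x within S)) \<or> pole_within h x S"
proof (cases "\<forall>\<^sub>F y in at x within S. h y = 0")
  case True
  thus ?thesis using tendsto_eventually by blast
next
  case False
  then obtain k c where c: "c \<noteq> 0" "((\<lambda>y. h y / (y - x) powi k) \<longlongrightarrow> c) (at x within S)"
    using assms unfolding finite_order_within_def by blast
  have eq: "\<forall>\<^sub>F y in at x within S. h y / (y - x) powi k * (y - x) powi k = h y"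
    using eventually_at_within_ne by eventually_elim simp
  have x0: "((\<lambda>y. y - x) \<longlongrightarrow> 0) (at x within S)"
    by (auto intro!: tendsto_eq_intros)
  show ?thesis
  proof (cases "k \<ge> 0")
    case True
    \<comment> \<open>The limit \<open>c * 0 powi k\<close> covers both signs of interest: it is
      \<open>c\<close> for \<open>k = 0\<close> and 0 for \<open>k > 0\<close>.\<close>
    have "((\<lambda>y. h y / (y - x) powi k * (y - x) powi k) \<longlongrightarrow> c * 0 powi k) (at x within S)"
      using c x0 True by (intro tendsto_mult tendsto_power_int') auto
    thus ?thesis using Lim_transform_eventually[OF _ eq] by blast
  next
    case False
    have "\<forall>\<^sub>F y in at x within S. y - x \<noteq> 0"
      using eventually_at_within_ne by eventually_elim simp
    hence "filterlim (\<lambda>y. (y - x) powi k) at_infinity (at x within S)"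
      using False x0 by (intro filterlim_power_int_neg_at_infinity) auto
    from tendsto_mult_filterlim_at_infinity[OF c(2,1) this]
    have "pole_within h x S"
      unfolding pole_within_def using eq by (simp add: filterlim_cong)
    thus ?thesis ..
  qed
qed

lemma not_tendsto_and_pole_within:
  assumes "at x within S \<noteq> bot" "(h \<longlongrightarrow> l) (at x within S)"
  shows "\<not> pole_within h x S"
  using not_tendsto_and_filterlim_at_infinity[OF assms] unfolding pole_within_def by blast

lemma nicely_mero_within_imp_tendsto:
  "nicely_mero_within h x S \<Longrightarrow> \<not> pole_within h x S \<Longrightarrow> (h \<longlongrightarrow> h x) (at x within S)"
  unfolding nicely_mero_within_def by blast

lemma not_pole_within_if_bounded:
  assumes "at x within S \<noteq> bot" and "\<forall>\<^sub>F y in at x within S. \<bar>h y\<bar> \<le> B"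
  shows "\<not> pole_within h x S"
proof
  assume "pole_within h x S"
  \<comment> \<open>The characterisation of \<open>at_infinity\<close> offers only positive bounds,
    hence the maximum with 0; adding 1 makes the bound exceed \<open>B\<close>.\<close>
  hence "\<forall>\<^sub>F y in at x within S. max 0 B + 1 \<le> \<bar>h y\<bar>"
    unfolding pole_within_def filterlim_at_infinity[OF order.refl] by fastforce
  hence "\<forall>\<^sub>F y in at x within S. False"
    using assms(2) by eventually_elim auto
  thus False using assms(1) by simp
qed

text \<open>The order at \<open>x\<close> bounds \<open>h\<close> near \<open>x\<close> by a
  constant times a power of the distance to \<open>x\<close>, and that power is bounded near every
  other point \<open>y\<close>. Nothing is assumed about the behaviour of \<open>h\<close> at
  \<open>y\<close> itself.\<close>

lemma eventually_not_pole_within: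
  assumes fin: "finite_order_within h x S" and perf: "\<And>y. y \<in> S \<Longrightarrow> at y within S \<noteq> bot"
  shows "\<forall>\<^sub>F y in at x within S. \<not> pole_within h y S"
proof -
  \<comment> \<open>Only an upper bound is wanted, so \<open>c = 0\<close> is allowed and a function
    vanishing near \<open>x\<close> can be given \<open>k = 0\<close>.\<close>
  obtain k c where lim: "((\<lambda>y. h y / (y - x) powi k) \<longlongrightarrow> c) (at x within S)"
  proof (cases "\<forall>\<^sub>F y in at x within S. h y = 0")
    case True
    hence "((\<lambda>y. h y / (y - x) powi 0) \<longlongrightarrow> 0) (at x within S)"
      by (simp add: tendsto_eventually)
    thus ?thesis by (rule that)
  qed (use that fin in \<open>auto simp: finite_order_within_def\<close>)
  have "\<forall>\<^sub>F y in at x within S. \<bar>h y / (y - x) powi k\<bar> < \<bar>c\<bar> + 1"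
    by (rule order_tendstoD(2)[OF tendsto_rabs[OF lim]]) simp
  hence "\<forall>\<^sub>F y in at x within S. \<forall>\<^sub>F z in at y within S. \<bar>h z / (z - x) powi k\<bar> < \<bar>c\<bar> + 1"
    by (rule eventually_nested_within)
  thus ?thesis using eventually_at_within_ne eventually_at_within_mem
  proof eventually_elim
    case (elim y)
    have "((\<lambda>z. (z - x) powi k) \<longlongrightarrow> (y - x) powi k) (at y within S)"
      using elim(2) by (intro tendsto_power_int tendsto_intros) auto
    from order_tendstoD(2)[OF tendsto_rabs[OF this], of "\<bar>(y - x) powi k\<bar> + 1"]
    have "\<forall>\<^sub>F z in at y within S. \<bar>(z - x) powi k\<bar> < \<bar>(y - x) powi k\<bar> + 1"
      by simp
    moreover have "((\<lambda>z. z) \<longlongrightarrow> y) (at y within S)" by (rule tendsto_ident_at)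
    hence "\<forall>\<^sub>F z in at y within S. z \<noteq> x"
      using elim(2) tendsto_imp_eventually_ne by blast
    ultimately have "\<forall>\<^sub>F z in at y within S. \<bar>h z\<bar> \<le> (\<bar>c\<bar> + 1) * (\<bar>(y - x) powi k\<bar> + 1)"
      using elim(1)
    proof eventually_elim
      case (elim z)
      have "\<bar>h z\<bar> = \<bar>h z / (z - x) powi k\<bar> * \<bar>(z - x) powi k\<bar>"
        using elim by simp
      also have "\<dots> \<le> (\<bar>c\<bar> + 1) * (\<bar>(y - x) powi k\<bar> + 1)"
        using elim by (intro mult_mono) auto
      finally show ?case .
    qed
    thus ?case using perf elim(3) not_pole_within_if_bounded by blast
  qed
qed

lemma eventually_nicely_mero_tendsto:
  assumes "\<And>y. y \<in> S \<Longrightarrow> at y within S \<noteq> bot" "\<And>y. y \<in> S \<Longrightarrow> nicely_mero_within h y S" "x \<in> S"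
  shows "\<forall>\<^sub>F y in at x within S. (h \<longlongrightarrow> h y) (at y within S)"
proof -
  have "\<forall>\<^sub>F y in at x within S. \<not> pole_within h y S"
    using assms eventually_not_pole_within unfolding nicely_mero_within_def by blast
  thus ?thesis using eventually_at_within_mem
    by eventually_elim (use assms nicely_mero_within_imp_tendsto in blast)
qed

text \<open>An identity theorem: vanishing near a point is a locally constant property of the point,
  hence constant on the connected set \<open>S\<close>.\<close>

lemma nicely_mero_zero_or_nonzero:
  assumes "connected S" "\<And>y. y \<in> S \<Longrightarrow> at y within S \<noteq> bot"
    and nice: "\<And>y. y \<in> S \<Longrightarrow> nicely_mero_within h y S"
  shows "(\<forall>x\<in>S. h x = 0) \<or> (\<forall>x\<in>S. \<forall>\<^sub>F y in at x within S. h y \<noteq> 0)"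
proof -
  define Z where "Z x \<longleftrightarrow> (\<forall>\<^sub>F y in at x within S. h y = 0)" for x
  have cases: "Z x \<or> (\<forall>\<^sub>F y in at x within S. h y \<noteq> 0)" if "x \<in> S" for x
    using nice[OF that] finite_order_within_zero_or_nonzero
    unfolding nicely_mero_within_def Z_def by blast
  have "\<forall>\<^sub>F y in at x within S. Z x = Z y" if x: "x \<in> S" for x
  proof (cases "Z x")
    case True
    thus ?thesis using eventually_nested_within[of "\<lambda>y. h y = 0"] unfolding Z_def
      by (auto elim: eventually_mono)
  next
    case False
    hence "\<forall>\<^sub>F y in at x within S. \<forall>\<^sub>F z in at y within S. h z \<noteq> 0"
      using cases x eventually_nested_within by blast
    thus ?thesis using eventually_at_within_mem
    proof eventually_elim
      case (elim y)
      have "\<not> Z y"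
      proof
        assume "Z y"
        hence "\<forall>\<^sub>F z in at y within S. False"
          using elim(1) unfolding Z_def by eventually_elim auto
        thus False using assms(2) elim(2) by auto
      qed
      thus ?case using False by simp
    qed
  qed
  hence const: "Z x = Z y" if "x \<in> S" "y \<in> S" for x y
    using connected_local_const[OF assms(1) that] by blast
  show ?thesis
  proof (cases "\<forall>x\<in>S. Z x")
    case True
    \<comment> \<open>Vanishing near \<open>x\<close> says nothing yet about \<open>h x\<close>. It
      is either the limit, which is 0, or the conventional value at a pole, again 0.\<close>
    have "h x = 0" if x: "x \<in> S" for x
    proof -
      have "(h \<longlongrightarrow> 0) (at x within S)"
        using True x unfolding Z_def by (simp add: tendsto_eventually)
      thus ?thesis
        using nice[OF x] assms(2)[OF x] tendsto_unique unfolding nicely_mero_within_def by blast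
    qed
    thus ?thesis by blast
  next
    case False
    thus ?thesis using const cases by blast
  qed
qed

lemma nicely_mero_eventually_nonzero:
  assumes "connected S" "\<And>y. y \<in> S \<Longrightarrow> at y within S \<noteq> bot"
    and "\<And>y. y \<in> S \<Longrightarrow> nicely_mero_within h y S" "\<exists>x\<in>S. h x \<noteq> 0" "x \<in> S"
  shows "\<forall>\<^sub>F y in at x within S. h y \<noteq> 0"
  using nicely_mero_zero_or_nonzero[OF assms(1-3)] assms(4,5) by blast

text \<open>Infinitely many exceptions would accumulate at a point of \<open>S\<close>, by
  Bolzano-Weierstrass, against the assumption at that point.\<close>

lemma finite_exceptions_compact:
  fixes S :: "real set"
  assumes "compact S" "\<And>x. x \<in> S \<Longrightarrow> \<forall>\<^sub>F y in at x within S. P y"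
  shows "finite {x \<in> S. \<not> P x}"
proof (rule ccontr)
  assume "infinite {x \<in> S. \<not> P x}"
  then obtain x where x: "x \<in> S" "x islimpt {x \<in> S. \<not> P x}"
    using Heine_Borel_imp_Bolzano_Weierstrass[OF assms(1)] by blast
  from assms(2)[OF x(1)] have "\<forall>\<^sub>F y in at x. \<not> (y \<in> S \<and> \<not> P y)"
    unfolding eventually_at_filter by (auto elim: eventually_mono)
  thus False using x(2) by (simp add: islimpt_iff_eventually)
qed

section \<open>Meromorphic quotients\<close>

lemma fill_sings_eq:
  assumes "at x within S \<noteq> bot" "(h \<longlongrightarrow> c) (at x within S)"
  shows "fill_sings S h x = c"
  using assms tendsto_Lim unfolding fill_sings_def by auto

lemma mero_quotient_eq:
  assumes "at x within S \<noteq> bot" "(p \<longlongrightarrow> p x) (at x within S)" "(q \<longlongrightarrow> q x) (at x within S)" "q x \<noteq> 0"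
  shows "mero_quotient S p q x = p x / q x"
  unfolding mero_quotient_def using assms by (intro fill_sings_eq tendsto_divide)

text \<open>The filled-in value is a limit and may differ from \<open>p y / q y\<close> where
  \<open>p\<close> or \<open>q\<close> has a pole or \<open>q\<close> vanishes. Such points are
  isolated, so equality holds on punctured neighbourhoods.\<close>

lemma mero_quotient_eventually_eq:
  assumes perf: "\<And>y. y \<in> S \<Longrightarrow> at y within S \<noteq> bot"
    and "\<And>y. y \<in> S \<Longrightarrow> nicely_mero_within p y S" "\<And>y. y \<in> S \<Longrightarrow> nicely_mero_within q y S"
    and "connected S" "\<exists>x\<in>S. q x \<noteq> 0" "x \<in> S"
  shows "\<forall>\<^sub>F y in at x within S. mero_quotient S p q y = p y / q y"
proof -
  have "\<forall>\<^sub>F y in at x within S. (p \<longlongrightarrow> p y) (at y within S)"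
    by (rule eventually_nicely_mero_tendsto) (use assms in auto)
  moreover have "\<forall>\<^sub>F y in at x within S. (q \<longlongrightarrow> q y) (at y within S)"
    by (rule eventually_nicely_mero_tendsto) (use assms in auto)
  moreover have "\<forall>\<^sub>F y in at x within S. q y \<noteq> 0"
    by (rule nicely_mero_eventually_nonzero) (use assms in auto)
  ultimately show ?thesis using eventually_at_within_mem
    by eventually_elim (simp add: mero_quotient_eq perf)
qed

lemma nicely_mero_quotient:
  assumes perf: "\<And>y. y \<in> S \<Longrightarrow> at y within S \<noteq> bot"
    and p: "\<And>y. y \<in> S \<Longrightarrow> nicely_mero_within p y S" and q: "\<And>y. y \<in> S \<Longrightarrow> nicely_mero_within q y S"
    and "connected S" "\<exists>x\<in>S. q x \<noteq> 0" "x \<in> S"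
  shows "nicely_mero_within (mero_quotient S p q) x S"
proof -
  have eq: "\<forall>\<^sub>F y in at x within S. mero_quotient S p q y = p y / q y"
    by (rule mero_quotient_eventually_eq) (use assms in auto)
  have "finite_order_within (\<lambda>y. p y / q y) x S"
    using p q \<open>x \<in> S\<close> finite_order_within_divide unfolding nicely_mero_within_def by blast
  moreover have "\<forall>\<^sub>F y in at x within S. p y / q y = mero_quotient S p q y"
    using eq by eventually_elim simp
  ultimately have fin: "finite_order_within (mero_quotient S p q) x S"
    by (metis finite_order_within_cong)
  have "(mero_quotient S p q \<longlongrightarrow> mero_quotient S p q x) (at x within S) \<or>
        pole_within (mero_quotient S p q) x S \<and> mero_quotient S p q x = 0"
  proof (cases "\<exists>l. (mero_quotient S p q \<longlongrightarrow> l) (at x within S)")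
    case True
    then obtain l where l: "(mero_quotient S p q \<longlongrightarrow> l) (at x within S)" ..
    have "((\<lambda>y. p y / q y) \<longlongrightarrow> l) (at x within S)"
      by (rule Lim_transform_eventually[OF l eq])
    hence "mero_quotient S p q x = l"
      unfolding mero_quotient_def using perf \<open>x \<in> S\<close> by (intro fill_sings_eq)
    thus ?thesis using l by simp
  next
    case False
    \<comment> \<open>Without a limit \<open>fill_sings\<close> returns its default 0, and finite
      order leaves a pole as the only possibility.\<close>
    have "\<nexists>l. ((\<lambda>y. p y / q y) \<longlongrightarrow> l) (at x within S)"
      using False tendsto_cong[OF eq] by blast
    hence "mero_quotient S p q x = 0"
      unfolding mero_quotient_def fill_sings_def by simp
    thus ?thesis using finite_order_within_tendsto_or_pole[OF fin] False by blast
  qed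
  with fin show ?thesis unfolding nicely_mero_within_def by blast
qed

text \<open>The order is the index of the first nonzero Taylor coefficient: dividing out that power
  leaves a series that is continuous at \<open>x\<close> with nonzero value.\<close>

lemma real_analytic_on_imp_nicely_mero:
  assumes f: "f real_analytic_on S" and x: "x \<in> S" and ne: "at x within S \<noteq> bot"
  shows "nicely_mero_within f x S"
proof -
  obtain e c where e: "e > 0"
    and sm: "\<And>y. y \<in> S \<Longrightarrow> \<bar>y - x\<bar> < e \<Longrightarrow> (\<lambda>n. c n * (y - x) ^ n) sums f y"
    using f x unfolding real_analytic_on_def by blast
  have fx: "f x = c 0"
    using sm[OF x] e by (simp add: powser_sums_zero_iff)
  have near: "\<forall>\<^sub>F y in at x within S. \<bar>y - x\<bar> < e"
    using eventually_at_ball[OF e, of x S] by eventually_elim (auto simp: dist_real_def)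
  have "\<forall>\<^sub>F y in at x within S. y \<in> S \<and> y \<noteq> x \<and> \<bar>y - x\<bar> < e"
    using near eventually_at_within_ne eventually_at_within_mem by eventually_elim simp
  \<comment> \<open>Convergence is known only for points of \<open>S\<close>, at an end point thus
    only on one side. Convergence at one \<open>y0\<close> different from \<open>x\<close> gives it
    on the full disc of radius \<open>\<bar>y0 - x\<bar>\<close>, as the limit theorem for power
    series requires.\<close>
  then obtain y0 where y0: "y0 \<in> S" "y0 \<noteq> x" "\<bar>y0 - x\<bar> < e"
    using ne eventually_happens' by blast
  define r where "r = \<bar>y0 - x\<bar>"
  have r: "r > 0" using y0 by (simp add: r_def)
  have summ: "summable (\<lambda>n. c n * w ^ n)" if "\<bar>w\<bar> < r" for w
    using powser_inside[OF sums_summable[OF sm[OF y0(1,3)]], of w] that by (simp add: r_def)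
  \<comment> \<open>The Taylor series without its first \<open>m\<close> terms, divided by
    \<open>w ^ m\<close>; its value at 0 is \<open>c m\<close>.\<close>
  define G where "G m w = (\<Sum>n. c (n + m) * w ^ n)" for m w
  have G: "((\<lambda>y. G m (y - x)) \<longlongrightarrow> c m) (at x within S)" for m
  proof -
    have "(G m \<longlongrightarrow> (\<lambda>n. c (n + m)) 0) (at 0)"
    proof (rule powser_limit_0[OF r])
      fix w :: real assume "norm w < r"
      thus "(\<lambda>n. c (n + m) * w ^ n) sums G m w"
        unfolding G_def by (intro summable_sums) (simp add: summable_powser_ignore_initial_segment summ)
    qed
    moreover have "filterlim (\<lambda>y. y - x) (at 0) (at x within S)"
      unfolding filterlim_at using eventually_at_within_ne[of x S]
      by (auto intro!: tendsto_eq_intros elim: eventually_mono)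
    ultimately show ?thesis using filterlim_compose by fastforce
  qed
  have near': "\<forall>\<^sub>F y in at x within S. y \<in> S \<and> y \<noteq> x \<and> \<bar>y - x\<bar> < e \<and> \<bar>y - x\<bar> < r"
    using near eventually_at_within_ne eventually_at_within_mem eventually_at_ball[OF r, of x S]
    by eventually_elim (auto simp: dist_real_def)
  have eq: "f y = (y - x) ^ m * G m (y - x)"
    if "y \<in> S" "\<bar>y - x\<bar> < e" "\<bar>y - x\<bar> < r" "\<And>n. n < m \<Longrightarrow> c n = 0" for y m
  proof -
    have "(\<lambda>n. c (n + m) * (y - x) ^ (n + m)) sums (f y - (\<Sum>n<m. c n * (y - x) ^ n))"
      by (rule sums_split_initial_segment) (rule sm[OF that(1,2)])
    moreover have "(\<lambda>n. (y - x) ^ m * (c (n + m) * (y - x) ^ n)) sums ((y - x) ^ m * G m (y - x))"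
      unfolding G_def
      by (intro sums_mult summable_sums) (use summ that(3) in \<open>simp add: summable_powser_ignore_initial_segment\<close>)
    ultimately show ?thesis using that(4)
      by (auto simp: power_add mult_ac dest: sums_unique2)
  qed
  have "finite_order_within f x S"
  proof (cases "\<forall>n. c n = 0")
    case True
    have "\<forall>\<^sub>F y in at x within S. f y = 0"
      using near' by eventually_elim (use eq[of _ 0] True in \<open>simp add: G_def\<close>)
    thus ?thesis unfolding finite_order_within_def ..
  next
    case False
    define m where "m = (LEAST n. c n \<noteq> 0)"
    have cm: "c m \<noteq> 0" using False unfolding m_def by (metis (mono_tags) LeastI)
    have less: "c n = 0" if "n < m" for n using that not_less_Least unfolding m_def by blast
    have "\<forall>\<^sub>F y in at x within S. G m (y - x) = f y / (y - x) powi int m"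
      using near' by eventually_elim (subst eq[of _ m], use less in auto)
    hence "((\<lambda>y. f y / (y - x) powi int m) \<longlongrightarrow> c m) (at x within S)"
      by (rule Lim_transform_eventually[OF G])
    thus ?thesis using cm unfolding finite_order_within_def by blast
  qed
  moreover have "\<forall>\<^sub>F y in at x within S. G 0 (y - x) = f y"
    using near' by eventually_elim (use eq[of _ 0] in simp)
  hence "(f \<longlongrightarrow> f x) (at x within S)"
    unfolding fx by (rule Lim_transform_eventually[OF G])
  ultimately show ?thesis unfolding nicely_mero_within_def by blast
qed

lemma nicely_mero_within_cong:
  assumes "\<And>y. y \<in> S \<Longrightarrow> g y = h y" "x \<in> S" "nicely_mero_within g x S"
  shows "nicely_mero_within h x S"
proof -
  have ev: "\<forall>\<^sub>F y in at x within S. g y = h y"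
    using eventually_at_within_mem by eventually_elim (use assms in auto)
  have "(h \<longlongrightarrow> l) (at x within S) \<longleftrightarrow> (g \<longlongrightarrow> l) (at x within S)" for l
    using tendsto_cong[OF ev] by blast
  moreover have "pole_within h x S \<longleftrightarrow> pole_within g x S"
    using filterlim_cong[OF refl refl ev] unfolding pole_within_def by blast
  ultimately show ?thesis
    using assms finite_order_within_cong[OF ev] unfolding nicely_mero_within_def by auto
qed

lemma at_within_Icc_neq_bot: "a < b \<Longrightarrow> x \<in> {a..b} \<Longrightarrow> at x within {a..b} \<noteq> bot" for x :: real
  by (simp add: trivial_limit_within)

lemma analytic_quotient_on_imp_nicely_mero:
  assumes "a < b" "analytic_quotient_on h a b" "x \<in> {a..b}"
  shows "nicely_mero_within h x {a..b}"
proof -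
  obtain p q where p: "p real_analytic_on {a..b}" and q: "q real_analytic_on {a..b}"
    and ne: "\<exists>x\<in>{a..b}. q x \<noteq> 0" and eq: "\<And>x. x \<in> {a..b} \<Longrightarrow> h x = mero_quotient {a..b} p q x"
    using assms(2) unfolding analytic_quotient_on_def by blast
  note perf = at_within_Icc_neq_bot[OF assms(1)]
  have "nicely_mero_within (mero_quotient {a..b} p q) x {a..b}"
    by (rule nicely_mero_quotient[OF perf _ _ _ ne assms(3)])
       (simp_all add: real_analytic_on_imp_nicely_mero[OF p] real_analytic_on_imp_nicely_mero[OF q] perf)
  from nicely_mero_within_cong[OF _ assms(3) this] show ?thesis
    using eq by simp
qed

section \<open>Poles, signs and derivatives\<close>

text \<open>The mean value inequality bounds \<open>h\<close> on a segment with end point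
  \<open>x\<close>. The segment is open, because the derivative is known only away from
  \<open>x\<close>.\<close>

lemma not_pole_within_if_deriv_bounded:
  fixes h g :: "real \<Rightarrow> real"
  assumes "convex S" "x \<in> S" and ne: "at x within S \<noteq> bot"
    and der: "\<forall>\<^sub>F y in at x within S. (h has_real_derivative g y) (at y within S)"
    and bd: "\<forall>\<^sub>F y in at x within S. \<bar>g y\<bar> \<le> B"
  shows "\<not> pole_within h x S"
proof
  assume pole: "pole_within h x S"
  from der bd have "\<forall>\<^sub>F y in at x within S. (h has_real_derivative g y) (at y within S) \<and> \<bar>g y\<bar> \<le> B"
    by eventually_elim simp
  then obtain d where d: "d > 0"
    "\<And>y. y \<in> S \<Longrightarrow> y \<noteq> x \<Longrightarrow> dist y x < d \<Longrightarrow> (h has_real_derivative g y) (at y within S) \<and> \<bar>g y\<bar> \<le> B"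
    unfolding eventually_at by blast
  have "S \<inter> ball x d - {x} \<noteq> {}"
    using ne d(1) unfolding not_trivial_limit_within_ball by blast
  then obtain y0 where "y0 \<in> S \<inter> ball x d - {x}"
    by blast
  hence y0: "y0 \<in> S" "y0 \<noteq> x" "dist y0 x < d"
    by (auto simp: dist_commute)
  define T where "T = open_segment x y0"
  have TS: "T \<subseteq> S"
    using assms(1,2) y0(1) unfolding T_def
    by (meson convex_contains_open_segment)
  have T: "dist y x < dist y0 x" "y \<noteq> x" if "y \<in> T" for y
    using that unfolding T_def open_segment_eq_real_ivl dist_real_def by (auto split: if_splits)
  have Tne: "at x within T \<noteq> bot"
    using y0(2) unfolding T_def open_segment_eq_real_ivl
    by (auto simp: trivial_limit_within islimpt_greaterThanLessThan1 islimpt_greaterThanLessThan2)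
  \<comment> \<open>Any fixed reference point of the segment would do. All points of the segment
    have distance less than \<open>d\<close> from \<open>x\<close>, whence the factor
    \<open>2 * d\<close> below.\<close>
  define m where "m = midpoint x y0"
  have m: "m \<in> T" using y0(2) unfolding m_def T_def by simp
  have "\<bar>h y\<bar> \<le> \<bar>h m\<bar> + \<bar>B\<bar> * (2 * d)" if y: "y \<in> T" for y
  proof -
    have "norm (h y - h m) \<le> \<bar>B\<bar> * norm (y - m)"
    proof (rule field_differentiable_bound[where S = T and f' = g])
      show "convex T" unfolding T_def by simp
      fix z assume z: "z \<in> T"
      have "(h has_real_derivative g z) (at z within S)" "\<bar>g z\<bar> \<le> B"
        using d(2)[of z] z TS T[OF z] y0(3) by auto
      thus "(h has_real_derivative g z) (at z within T)" "norm (g z) \<le> \<bar>B\<bar>"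
        using TS by (auto intro: DERIV_subset)
    qed (use y m in auto)
    moreover have "norm (y - m) \<le> 2 * d"
      using T(1)[OF y] T(1)[OF m] y0(3) by (auto simp: dist_real_def)
    hence "\<bar>B\<bar> * norm (y - m) \<le> \<bar>B\<bar> * (2 * d)"
      by (intro mult_left_mono) auto
    ultimately show ?thesis by simp
  qed
  hence "\<forall>\<^sub>F y in at x within T. \<bar>h y\<bar> \<le> \<bar>h m\<bar> + \<bar>B\<bar> * (2 * d)"
    using eventually_at_within_mem[of T x] by (auto elim: eventually_mono)
  moreover have "pole_within h x T"
    using pole at_le[OF TS] unfolding pole_within_def by (rule filterlim_mono[OF _ order.refl])
  ultimately show False
    using not_pole_within_if_bounded[OF Tne] by blast
qed

text \<open>Near \<open>x\<close> the ratio \<open>g y / (y - x) powi k\<close> keeps the sign of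
  \<open>c\<close>, while an odd power takes opposite signs on the two sides. Continuity then forces
  \<open>g x = 0\<close>.\<close>

lemma sign_changing_zero_if_odd_order:
  assumes cont: "(g \<longlongrightarrow> g x) (at x)" and "odd k" "c \<noteq> 0"
    and lim: "((\<lambda>y. g y / (y - x) powi k) \<longlongrightarrow> c) (at x)"
  shows "sign_changing_zero g x"
proof -
  \<comment> \<open>Multiplying by \<open>c\<close> makes the limit a positive square, which avoids
    distinguishing the sign of \<open>c\<close> at this stage.\<close>
  have "((\<lambda>y. c * (g y / (y - x) powi k)) \<longlongrightarrow> c * c) (at x)"
    by (intro tendsto_intros lim)
  moreover have "0 < c * c"
    using \<open>c \<noteq> 0\<close> not_real_square_gt_zero by blast
  ultimately have "\<forall>\<^sub>F y in at x. 0 < c * (g y / (y - x) powi k)"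
    by (rule order_tendstoD(1))
  then obtain d where d: "d > 0" and pos: "\<And>y. y \<noteq> x \<Longrightarrow> dist y x < d \<Longrightarrow> 0 < c * (g y / (y - x) powi k)"
    unfolding eventually_at by blast
  have neg: "g y * g z < 0" if "dist y x < d" "dist z x < d" "y < x" "x < z" for y z
  proof -
    have "(y - x) powi k = - ((x - y) powi k)"
      using power_int_minus_left_odd[OF \<open>odd k\<close>, of "x - y"] by simp
    hence 1: "(y - x) powi k < 0" using that by simp
    have 2: "(z - x) powi k > 0" using that by simp
    have "c * g y = c * (g y / (y - x) powi k) * (y - x) powi k"
      using \<open>y < x\<close> by simp
    also have "\<dots> < 0"
      by (rule mult_pos_neg) (use pos[of y] that 1 in auto)
    finally have 3: "c * g y < 0" .
    have "0 < c * (g z / (z - x) powi k) * (z - x) powi k"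
      by (rule mult_pos_pos) (use pos[of z] that 2 in auto)
    also have "\<dots> = c * g z"
      using \<open>x < z\<close> by simp
    finally have 4: "0 < c * g z" .
    show ?thesis
    proof (cases "c > 0")
      case True
      thus ?thesis using 3 4 by (intro mult_neg_pos) (simp_all add: mult_less_0_iff zero_less_mult_iff)
    next
      case False
      thus ?thesis using 3 4 by (intro mult_pos_neg) (simp_all add: mult_less_0_iff zero_less_mult_iff)
    qed
  qed
  have "g x = 0"
  proof (rule ccontr)
    assume nz: "g x \<noteq> 0"
    have "((\<lambda>y. g x * g y) \<longlongrightarrow> g x * g x) (at x)"
      by (intro tendsto_intros cont)
    moreover have "0 < g x * g x"
      using nz not_real_square_gt_zero by blast
    ultimately have "\<forall>\<^sub>F y in at x. 0 < g x * g y"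
      by (rule order_tendstoD(1))
    then obtain e where e: "e > 0" "\<And>y. y \<noteq> x \<Longrightarrow> dist y x < e \<Longrightarrow> 0 < g x * g y"
      unfolding eventually_at by blast
    \<comment> \<open>At \<open>x - t\<close> and \<open>x + t\<close> the function would have the
      sign of \<open>g x\<close>, yet their values have opposite signs.\<close>
    define t where "t = min d e / 2"
    have t: "t > 0" "t < d" "t < e" using d e(1) by (auto simp: t_def)
    have "0 < g x * g (x - t)" "0 < g x * g (x + t)"
      using t by (auto intro!: e(2) simp: dist_real_def)
    moreover have "g (x - t) * g (x + t) < 0"
      using t by (intro neg) (auto simp: dist_real_def)
    ultimately show False
      by (metis mult_less_0_iff zero_less_mult_iff order.asym)
  qed
  moreover have "\<not> is_pole g x"
    using cont not_tendsto_and_filterlim_at_infinity[of "at x"] unfolding is_pole_def by auto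
  moreover have "\<forall>y\<in>{x - d<..<x + d}. \<forall>z\<in>{x - d<..<x + d}. y < x \<and> x < z \<longrightarrow> g y * g z < 0"
    using neg by (auto simp: dist_real_def)
  ultimately show ?thesis
    using d unfolding sign_changing_zero_def by blast
qed

lemma at_within_open_subset: "open J \<Longrightarrow> J \<subseteq> S \<Longrightarrow> x \<in> J \<Longrightarrow> at x within S = at x"
  by (rule at_within_interior) (use interior_maximal in blast)

lemma pole_within_iff_is_pole: "open J \<Longrightarrow> J \<subseteq> S \<Longrightarrow> x \<in> J \<Longrightarrow> pole_within h x S \<longleftrightarrow> is_pole h x"
  unfolding pole_within_def is_pole_def by (simp only: at_within_open_subset)

text \<open>
  Unless \<open>g\<close> vanishes identically, it has even order at every point of \<open>J\<close>, hence a strict sign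
  on a punctured neighbourhood; that sign is locally constant in the point.
\<close>

lemma nicely_mero_constant_sign:
  assumes "connected S" and perf: "\<And>y. y \<in> S \<Longrightarrow> at y within S \<noteq> bot"
    and nice: "\<And>y. y \<in> S \<Longrightarrow> nicely_mero_within g y S"
    and J: "open J" "connected J" "J \<subseteq> S"
    and no_pole: "\<And>x. x \<in> J \<Longrightarrow> \<not> is_pole g x"
    and no_scz: "\<And>x. x \<in> J \<Longrightarrow> \<not> sign_changing_zero g x"
  shows "(\<forall>x\<in>J. 0 \<le> g x) \<or> (\<forall>x\<in>J. g x \<le> 0)"
proof (cases "\<forall>x\<in>S. g x = 0")
  case True
  thus ?thesis using J by auto
next
  case False
  note atS = at_within_open_subset[OF J(1,3)]
  have cont: "(g \<longlongrightarrow> g x) (at x)" if "x \<in> J" for x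
    using nicely_mero_within_imp_tendsto[of g x S] nice no_pole that J atS[OF that]
      pole_within_iff_is_pole[OF J(1,3) that] by auto
  have sgn: "(\<forall>\<^sub>F y in at x. 0 < g y) \<or> (\<forall>\<^sub>F y in at x. g y < 0)" if x: "x \<in> J" for x
  proof -
    \<comment> \<open>The identity theorem rules out the vanishing alternative of finite order, so
      an order \<open>k\<close> exists at \<open>x\<close>.\<close>
    have "\<forall>\<^sub>F y in at x within S. g y \<noteq> 0"
      by (rule nicely_mero_eventually_nonzero) (use assms False x in auto)
    moreover have "\<forall>\<^sub>F y in at x within S. False"
      if "\<forall>\<^sub>F y in at x within S. g y \<noteq> 0" "\<forall>\<^sub>F y in at x within S. g y = 0"
      using that by eventually_elim simp
    ultimately have "\<not> (\<forall>\<^sub>F y in at x within S. g y = 0)"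
      using perf[of x] x J(3) by auto
    then obtain k c where c: "c \<noteq> 0" and lim: "((\<lambda>y. g y / (y - x) powi k) \<longlongrightarrow> c) (at x)"
      using nice[of x] x J(3) atS[OF x]
      unfolding nicely_mero_within_def finite_order_within_def by auto
    have k: "even k"
      using sign_changing_zero_if_odd_order[OF cont[OF x] _ c lim] no_scz[OF x] by blast
    have pos: "0 < (y - x) powi k" if "y \<noteq> x" for y
    proof (cases "y > x")
      case False
      have "(y - x) powi k = (x - y) powi k"
        using power_int_minus_left_even[OF k, of "x - y"] by simp
      thus ?thesis using False that by simp
    qed simp
    show ?thesis
    proof (cases "c > 0")
      case True
      have "\<forall>\<^sub>F y in at x. 0 < g y"
        using order_tendstoD(1)[OF lim True] eventually_at_within_ne[of x UNIV]
        by eventually_elim (metis pos zero_less_divide_iff order.asym)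
      thus ?thesis ..
    next
      case False
      hence "c < 0" using c by simp
      have "\<forall>\<^sub>F y in at x. g y < 0"
        using order_tendstoD(2)[OF lim \<open>c < 0\<close>] eventually_at_within_ne[of x UNIV]
        by eventually_elim (metis pos divide_less_0_iff order.asym)
      thus ?thesis ..
    qed
  qed
  define P where "P x \<longleftrightarrow> (\<forall>\<^sub>F y in at x. 0 < g y)" for x
  have "\<forall>\<^sub>F y in at x. P x = P y" if x: "x \<in> J" for x
  proof (cases "P x")
    case True
    thus ?thesis using eventually_nested_within[of "\<lambda>y. 0 < g y" x UNIV] unfolding P_def
      by (auto elim: eventually_mono)
  next
    case False
    hence "\<forall>\<^sub>F y in at x. \<forall>\<^sub>F z in at y. g z < 0"
      using sgn x eventually_nested_within unfolding P_def by blast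
    hence "\<forall>\<^sub>F y in at x. \<not> P y"
    proof eventually_elim
      case (elim y)
      have False if "P y"
      proof -
        have "\<forall>\<^sub>F z in at y. False"
          using elim that unfolding P_def by eventually_elim auto
        thus False by simp
      qed
      thus ?case by blast
    qed
    thus ?thesis using False by simp
  qed
  hence const: "P x = P y" if "x \<in> J" "y \<in> J" for x y
    using connected_local_const[OF J(2) that, of P] at_within_open_subset[OF J(1) order.refl] by simp
  \<comment> \<open>\<open>P x\<close> speaks only of points other than \<open>x\<close>; the value
    at \<open>x\<close> is a limit of positive numbers and can be 0.\<close>
  have "0 \<le> g x" if "x \<in> J" "P x" for x
    by (rule tendsto_lowerbound[OF cont[OF that(1)]])
       (use that in \<open>auto simp: P_def elim: eventually_mono\<close>)
  moreover have "g x \<le> 0" if "x \<in> J" "\<not> P x" for x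
    by (rule tendsto_upperbound[OF cont[OF that(1)]])
       (use that(2) sgn[OF that(1)] in \<open>auto simp: P_def elim: eventually_mono\<close>)
  ultimately show ?thesis using const by blast
qed

lemma quotient_not_pole_if_deriv_regular:
  assumes "convex S" and perf: "\<And>y. y \<in> S \<Longrightarrow> at y within S \<noteq> bot"
    and h: "\<And>y. y \<in> S \<Longrightarrow> nicely_mero_within h y S"
    and g: "\<And>y. y \<in> S \<Longrightarrow> nicely_mero_within g y S"
    and der: "\<And>y. y \<in> S \<Longrightarrow> \<not> pole_within h y S \<Longrightarrow> \<not> pole_within g y S \<Longrightarrow>
      (h has_real_derivative g y) (at y within S)"
    and x: "x \<in> S" and "\<not> pole_within g x S"
  shows "\<not> pole_within h x S"
proof (rule not_pole_within_if_deriv_bounded[OF assms(1) x perf[OF x]])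
  have "\<forall>\<^sub>F y in at x within S. \<not> pole_within h y S" "\<forall>\<^sub>F y in at x within S. \<not> pole_within g y S"
    using eventually_not_pole_within perf h g x unfolding nicely_mero_within_def by blast+
  thus "\<forall>\<^sub>F y in at x within S. (h has_real_derivative g y) (at y within S)"
    using eventually_at_within_mem[of S x] by eventually_elim (rule der)
  have "(g \<longlongrightarrow> g x) (at x within S)"
    using g[OF x] assms(7) by (rule nicely_mero_within_imp_tendsto)
  from order_tendstoD(2)[OF tendsto_rabs[OF this], of "\<bar>g x\<bar> + 1"]
  show "\<forall>\<^sub>F y in at x within S. \<bar>g y\<bar> \<le> \<bar>g x\<bar> + 1"
    by (auto elim: eventually_mono)
qed

section \<open>One step of a Budan-Fourier sequence\<close>

text \<open>Here \<open>p\<close>, \<open>q\<close>, \<open>r\<close> stand for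
  \<open>\<psi> (k - 1)\<close>, \<open>\<psi> k\<close>, \<open>\<rho> k\<close>. Analyticity
  enters only through \<open>nicely_mero_within\<close>, so that \<open>\<psi> 0 = f\<close> and the
  later quotients are treated alike.\<close>

locale GBF_step =
  fixes a b :: real and p q r :: "real \<Rightarrow> real"
  assumes ab: "a < b"
    and p: "\<And>x. x \<in> {a..b} \<Longrightarrow> nicely_mero_within p x {a..b}"
    and q: "\<And>x. x \<in> {a..b} \<Longrightarrow> nicely_mero_within q x {a..b}"
    and r: "\<And>x. x \<in> {a..b} \<Longrightarrow> nicely_mero_within r x {a..b}"
    and r_nonzero: "\<exists>x\<in>{a..b}. r x \<noteq> 0"
    and deriv: "\<And>x. x \<in> {a..b} \<Longrightarrow> \<not> pole_within (mero_quotient {a..b} p r) x {a..b} \<Longrightarrow>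
      \<not> pole_within (mero_quotient {a..b} q r) x {a..b} \<Longrightarrow>
      (mero_quotient {a..b} p r has_real_derivative mero_quotient {a..b} q r x) (at x within {a..b})"
begin

abbreviation S :: "real set" where "S \<equiv> {a..b}"
abbreviation h :: "real \<Rightarrow> real" where "h \<equiv> mero_quotient {a..b} p r"
abbreviation g :: "real \<Rightarrow> real" where "g \<equiv> mero_quotient {a..b} q r"

lemmas perf = at_within_Icc_neq_bot[OF ab]

lemma nicely_mero_h: "x \<in> S \<Longrightarrow> nicely_mero_within h x S"
  by (rule nicely_mero_quotient[OF perf p r _ r_nonzero]) auto

lemma nicely_mero_g: "x \<in> S \<Longrightarrow> nicely_mero_within g x S"
  by (rule nicely_mero_quotient[OF perf q r _ r_nonzero]) auto

lemma h_eventually_eq: "x \<in> S \<Longrightarrow> \<forall>\<^sub>F y in at x within S. h y = p y / r y"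
  by (rule mero_quotient_eventually_eq[OF perf p r _ r_nonzero]) auto

lemma g_eventually_eq: "x \<in> S \<Longrightarrow> \<forall>\<^sub>F y in at x within S. g y = q y / r y"
  by (rule mero_quotient_eventually_eq[OF perf q r _ r_nonzero]) auto

lemma r_eventually_nonzero: "x \<in> S \<Longrightarrow> \<forall>\<^sub>F y in at x within S. r y \<noteq> 0"
  by (rule nicely_mero_eventually_nonzero[OF _ perf r r_nonzero]) auto

lemma h_not_pole: "x \<in> S \<Longrightarrow> \<not> pole_within g x S \<Longrightarrow> \<not> pole_within h x S"
  by (rule quotient_not_pole_if_deriv_regular[OF _ perf nicely_mero_h nicely_mero_g deriv]) auto

text \<open>Constancy of \<open>h\<close> yields \<open>p = c * r\<close> only off isolated points.
  Limits extend it to the regular points, and at common poles both sides are 0 by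
  convention.\<close>

lemma p_eq_const_times_r:
  assumes q0: "\<forall>x\<in>S. q x = 0"
  shows "\<exists>c. \<forall>x\<in>S. p x = c * r x"
proof -
  have g0: "g x = 0" if "x \<in> S" for x
  proof -
    have "\<forall>\<^sub>F y in at x within S. q y / r y = 0"
      using eventually_at_within_mem[of S x] by eventually_elim (use q0 in simp)
    thus ?thesis
      unfolding mero_quotient_def by (intro fill_sings_eq perf that tendsto_eventually)
  qed
  have "\<not> pole_within g x S" if "x \<in> S" for x
  proof (rule not_pole_within_if_bounded[OF perf[OF that], of _ 0])
    show "\<forall>\<^sub>F y in at x within S. \<bar>g y\<bar> \<le> 0"
      using eventually_at_within_mem[of S x] by eventually_elim (use g0 in simp)
  qed
  hence "(h has_real_derivative 0) (at x within S)" if "x \<in> S" for x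
    using deriv[of x] h_not_pole[of x] g0[of x] that by simp
  hence "\<exists>c. \<forall>x\<in>S. h x = c"
    by (intro has_field_derivative_zero_constant) auto
  then obtain c where c: "\<And>x. x \<in> S \<Longrightarrow> h x = c" by blast
  have "p x = c * r x" if x: "x \<in> S" for x
  proof -
    have ev: "\<forall>\<^sub>F y in at x within S. c * r y = p y"
      using h_eventually_eq[OF x] r_eventually_nonzero[OF x] eventually_at_within_mem[of S x]
    proof eventually_elim
      case (elim y)
      thus ?case using c[of y] by (metis nonzero_divide_eq_eq)
    qed
    show ?thesis
    proof (cases "pole_within r x S \<and> c \<noteq> 0")
      case True
      hence "filterlim (\<lambda>y. c * r y) at_infinity (at x within S)"
        unfolding pole_within_def by (intro tendsto_mult_filterlim_at_infinity[OF tendsto_const]) auto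
      hence "pole_within p x S"
        using filterlim_cong[OF refl refl ev] unfolding pole_within_def by blast
      hence "p x = 0"
        using p[OF x] not_tendsto_and_pole_within[OF perf[OF x]] unfolding nicely_mero_within_def by blast
      moreover have "r x = 0"
        using True r[OF x] not_tendsto_and_pole_within[OF perf[OF x]] unfolding nicely_mero_within_def by blast
      ultimately show ?thesis by simp
    next
      case False
      \<comment> \<open>For \<open>c = 0\<close> the product is the zero function even if
        \<open>r\<close> has a pole at \<open>x\<close>; otherwise \<open>r\<close> is continuous
        there.\<close>
      have "((\<lambda>y. c * r y) \<longlongrightarrow> c * r x) (at x within S)"
      proof (cases "c = 0")
        case False
        with \<open>\<not> (pole_within r x S \<and> c \<noteq> 0)\<close> have "(r \<longlongrightarrow> r x) (at x within S)"
          using r[OF x] nicely_mero_within_imp_tendsto by blast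
        thus ?thesis by (rule tendsto_mult_left)
      qed simp
      hence lim: "(p \<longlongrightarrow> c * r x) (at x within S)"
        using ev by (rule Lim_transform_eventually)
      hence "(p \<longlongrightarrow> p x) (at x within S)"
        using p[OF x] not_tendsto_and_pole_within[OF perf[OF x]] unfolding nicely_mero_within_def by blast
      thus ?thesis using lim tendsto_unique[OF perf[OF x]] by blast
    qed
  qed
  thus ?thesis by blast
qed

lemma finite_grid: "finite (GBF_grid a b q r)"
proof -
  have int: "\<not> is_pole \<phi> x \<longleftrightarrow> \<not> pole_within \<phi> x S" if "x \<in> {a<..<b}" for \<phi> x
    using pole_within_iff_is_pole[of "{a<..<b}" S x \<phi>] that by (auto simp: greaterThanLessThan_subseteq_atLeastAtMost_iff)
  \<comment> \<open>The double negation fits the shape of \<open>finite_exceptions_compact\<close>,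
    whose exceptional set is given by a negated property.\<close>
  have poles: "finite {x \<in> S. \<not> \<not> pole_within \<phi> x S}"
    if "\<And>x. x \<in> S \<Longrightarrow> nicely_mero_within \<phi> x S" for \<phi>
  proof (rule finite_exceptions_compact)
    fix x assume "x \<in> S"
    hence "finite_order_within \<phi> x S"
      using that unfolding nicely_mero_within_def by blast
    thus "\<forall>\<^sub>F y in at x within S. \<not> pole_within \<phi> y S"
      by (rule eventually_not_pole_within) (rule perf)
  qed simp
  have zeros: "finite {x \<in> S. \<not> \<phi> x \<noteq> 0}"
    if "\<And>x. x \<in> S \<Longrightarrow> nicely_mero_within \<phi> x S" "\<exists>x\<in>S. \<phi> x \<noteq> 0" for \<phi>
  proof (rule finite_exceptions_compact)
    fix x assume "x \<in> S"
    thus "\<forall>\<^sub>F y in at x within S. \<phi> y \<noteq> 0"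
      by (intro nicely_mero_eventually_nonzero[OF _ perf that]) auto
  qed simp
  have "finite {x \<in> {a<..<b}. sign_changing_zero q x}"
  proof (cases "\<forall>x\<in>S. q x = 0")
    case True
    have "\<not> sign_changing_zero q x" if x: "x \<in> {a<..<b}" for x
    proof
      assume "sign_changing_zero q x"
      then obtain e where e: "e > 0"
        "\<forall>y\<in>{x - e<..<x + e}. \<forall>z\<in>{x - e<..<x + e}. y < x \<and> x < z \<longrightarrow> q y * q z < 0"
        unfolding sign_changing_zero_def by blast
      \<comment> \<open>The maximum keeps \<open>y\<close> inside \<open>S\<close>, where
        \<open>q\<close> vanishes. The partner \<open>x + e / 2\<close> may lie beyond
        \<open>b\<close>, where \<open>q\<close> is unknown, but one zero factor is enough.\<close>
      define y where "y = max ((x + a) / 2) (x - e / 2)"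
      have "y < x" "x - e < y" "y \<in> S" using e(1) x by (auto simp: y_def less_max_iff_disj max_def)
      hence "q y * q (x + e / 2) < 0" using e by auto
      thus False using \<open>y \<in> S\<close> True by simp
    qed
    hence "{x \<in> {a<..<b}. sign_changing_zero q x} = {}" by blast
    thus ?thesis by (metis finite.emptyI)
  next
    case False
    have "{x \<in> {a<..<b}. sign_changing_zero q x} \<subseteq> {x \<in> S. \<not> q x \<noteq> 0}"
      by (auto simp: sign_changing_zero_def)
    thus ?thesis using zeros[OF q] False finite_subset by blast
  qed
  moreover have "GBF_grid a b q r \<subseteq> {x \<in> S. \<not> \<not> pole_within q x S} \<union>
      {x \<in> {a<..<b}. sign_changing_zero q x} \<union> {x \<in> S. \<not> r x \<noteq> 0} \<union> {x \<in> S. \<not> \<not> pole_within r x S}"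
    using int unfolding GBF_grid_def by fastforce
  ultimately show ?thesis
    using poles[OF q] poles[OF r] zeros[OF r r_nonzero] by (meson finite_UnI finite_subset)
qed


section \<open>Open intervals without grid points\<close>

context
  fixes u v :: real
  assumes uv: "{u<..<v} \<subseteq> {a<..<b}" and off_grid: "{u<..<v} \<inter> GBF_grid a b q r = {}"
begin

abbreviation J :: "real set" where "J \<equiv> {u<..<v}"

lemma J_subset: "J \<subseteq> S"
  using uv greaterThanLessThan_subseteq_atLeastAtMost_iff by fastforce

lemma at_J: "x \<in> J \<Longrightarrow> at x within S = at x"
  by (rule at_within_open_subset[OF _ J_subset]) auto

lemma pole_J: "x \<in> J \<Longrightarrow> pole_within \<phi> x S \<longleftrightarrow> is_pole \<phi> x"
  by (rule pole_within_iff_is_pole[OF _ J_subset]) auto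

lemma q_r_on_J:
  assumes x: "x \<in> J"
  shows "(q \<longlongrightarrow> q x) (at x)" "(r \<longlongrightarrow> r x) (at x)" "r x \<noteq> 0" "\<not> sign_changing_zero q x"
proof -
  have *: "\<not> is_pole q x" "\<not> is_pole r x" "r x \<noteq> 0" "\<not> sign_changing_zero q x"
    using subsetD[OF uv x] disjoint_iff[THEN iffD1, OF off_grid] x unfolding GBF_grid_def by blast+
  have "x \<in> S" using x J_subset by blast
  thus "(q \<longlongrightarrow> q x) (at x)" "(r \<longlongrightarrow> r x) (at x)"
    using nicely_mero_within_imp_tendsto[OF q] nicely_mero_within_imp_tendsto[OF r]
      *(1,2) pole_J[OF x] at_J[OF x] by metis+
  show "r x \<noteq> 0" "\<not> sign_changing_zero q x" using * by auto
qed

lemma g_on_J: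
  assumes x: "x \<in> J"
  shows "g x = q x / r x" "(g \<longlongrightarrow> g x) (at x)" "\<not> pole_within g x S"
proof -
  have xS: "x \<in> S" using x J_subset by blast
  show eq: "g x = q x / r x"
    by (rule mero_quotient_eq[OF perf[OF xS]]) (use q_r_on_J[OF x] at_J[OF x] in simp_all)
  have ev: "\<forall>\<^sub>F y in at x. q y / r y = g y"
    using g_eventually_eq[OF xS] unfolding at_J[OF x] by eventually_elim simp
  have "((\<lambda>y. q y / r y) \<longlongrightarrow> g x) (at x)"
    unfolding eq by (intro tendsto_divide q_r_on_J x)
  thus *: "(g \<longlongrightarrow> g x) (at x)"
    using ev by (rule Lim_transform_eventually)
  show "\<not> pole_within g x S"
    by (rule not_tendsto_and_pole_within[OF perf[OF xS]]) (use * at_J[OF x] in simp)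
qed

lemma h_deriv_on_J: "x \<in> J \<Longrightarrow> (h has_real_derivative g x) (at x)"
  using deriv[of x] h_not_pole[of x] g_on_J(3)[of x] J_subset at_J[of x] by auto

text \<open>The identity \<open>p = h * r\<close> is known only near \<open>x\<close>. Both factors
  are continuous at \<open>x\<close>, so \<open>p\<close> has a finite limit there, and for
  \<open>p\<close> a finite limit is its value.\<close>

lemma p_on_J:
  assumes x: "x \<in> J"
  shows "\<not> is_pole p x" "p x = h x * r x"
proof -
  have xS: "x \<in> S" using x J_subset by blast
  have "\<forall>\<^sub>F y in at x. h y * r y = p y"
    using h_eventually_eq[OF xS] r_eventually_nonzero[OF xS] unfolding at_J[OF x]
    by eventually_elim simp
  moreover have "(h \<longlongrightarrow> h x) (at x)"
    using h_deriv_on_J[OF x] DERIV_isCont isContD by blast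
  hence "((\<lambda>y. h y * r y) \<longlongrightarrow> h x * r x) (at x)"
    by (intro tendsto_mult q_r_on_J x)
  ultimately have lim: "(p \<longlongrightarrow> h x * r x) (at x)"
    by (rule Lim_transform_eventually[rotated])
  thus np: "\<not> is_pole p x"
    using not_tendsto_and_filterlim_at_infinity[of "at x"] unfolding is_pole_def by auto
  have "(p \<longlongrightarrow> p x) (at x)"
    using nicely_mero_within_imp_tendsto[OF p[OF xS]] np pole_J[OF x] at_J[OF x] by simp
  thus "p x = h x * r x" using lim tendsto_unique[of "at x"] by auto
qed

text \<open>Near \<open>x\<close> the pivot \<open>r\<close> keeps its sign, so a sign change of
  \<open>g = q / r\<close> would be one of \<open>q\<close>, making \<open>x\<close> a grid
  point.\<close>

lemma g_no_sign_change_on_J: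
  assumes x: "x \<in> J"
  shows "\<not> sign_changing_zero g x"
proof
  assume scz: "sign_changing_zero g x"
  then obtain e where e: "e > 0"
    "\<And>y z. y \<in> {x - e<..<x + e} \<Longrightarrow> z \<in> {x - e<..<x + e} \<Longrightarrow> y < x \<Longrightarrow> x < z \<Longrightarrow> g y * g z < 0"
    unfolding sign_changing_zero_def by blast
  have "((\<lambda>y. r x * r y) \<longlongrightarrow> r x * r x) (at x)"
    by (intro tendsto_intros q_r_on_J x)
  moreover have "0 < r x * r x"
    using q_r_on_J(3)[OF x] not_real_square_gt_zero by blast
  ultimately have "\<forall>\<^sub>F y in at x. 0 < r x * r y"
    by (rule order_tendstoD(1))
  moreover have "\<forall>\<^sub>F y in at x. y \<in> J"
    using x eventually_at_in_open'[of J x] by simp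
  ultimately have "\<forall>\<^sub>F y in at x. 0 < r x * r y \<and> y \<in> J"
    by eventually_elim simp
  then obtain d where d: "d > 0" "\<forall>y. y \<noteq> x \<and> dist y x < d \<longrightarrow> 0 < r x * r y \<and> y \<in> J"
    unfolding eventually_at by auto
  have neg: "q y * q z < 0"
    if "y \<in> {x - min d e<..<x + min d e}" "z \<in> {x - min d e<..<x + min d e}" "y < x" "x < z" for y z
  proof -
    have y: "0 < r x * r y" "y \<in> J" and z: "0 < r x * r z" "z \<in> J"
      using d(2)[rule_format, of y] d(2)[rule_format, of z] that by (auto simp: dist_real_def)
    \<comment> \<open>Both \<open>r y\<close> and \<open>r z\<close> have the sign of
      \<open>r x\<close>, so the second factor is positive.\<close>
    have "q y * q z = (g y * g z) * (r y * r z)"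
      using g_on_J(1)[OF y(2)] g_on_J(1)[OF z(2)] y z by auto
    moreover have "g y * g z < 0" using e(2)[of y z] that by auto
    moreover have "0 < r y * r z"
      using y(1) z(1) by (metis zero_less_mult_iff order.asym)
    ultimately show ?thesis by (simp add: mult_neg_pos)
  qed
  have "q x = 0"
    using scz g_on_J(1)[OF x] q_r_on_J(3)[OF x] unfolding sign_changing_zero_def by simp
  moreover have "\<not> is_pole q x"
    using q_r_on_J(1)[OF x] not_tendsto_and_filterlim_at_infinity[of "at x"] unfolding is_pole_def by auto
  moreover have "min d e > 0" using d(1) e(1) by simp
  ultimately have "sign_changing_zero q x"
    using neg unfolding sign_changing_zero_def by blast
  thus False using q_r_on_J(4)[OF x] by blast
qed

lemma h_monotone_on_J: "mono_on J h \<or> antimono_on J h"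
proof -
  have "(\<forall>x\<in>J. 0 \<le> g x) \<or> (\<forall>x\<in>J. g x \<le> 0)"
    by (rule nicely_mero_constant_sign[OF _ perf nicely_mero_g _ _ J_subset])
       (use g_on_J(3) pole_J g_no_sign_change_on_J in auto)
  thus ?thesis
  proof
    assume *: "\<forall>x\<in>J. 0 \<le> g x"
    have "h x \<le> h y" if "x \<in> J" "y \<in> J" "x \<le> y" for x y
      by (rule DERIV_nonneg_imp_nondecreasing[OF that(3)])
         (meson h_deriv_on_J * that atLeastAtMost_iff connectedD_interval connected_Ioo)
    thus ?thesis by (auto intro!: mono_onI)
  next
    assume *: "\<forall>x\<in>J. g x \<le> 0"
    have "h y \<le> h x" if "x \<in> J" "y \<in> J" "x \<le> y" for x y
      by (rule DERIV_nonpos_imp_nonincreasing[OF that(3)])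
         (meson h_deriv_on_J * that atLeastAtMost_iff connectedD_interval connected_Ioo)
    thus ?thesis by (auto intro!: monotone_onI)
  qed
qed

lemma p_sign_changing_zero_unique_on_J: "\<exists>\<^sub>\<le>\<^sub>1 x. x \<in> J \<and> sign_changing_zero p x"
proof -
  have False if x: "x \<in> J" "sign_changing_zero p x" and y: "y \<in> J" "sign_changing_zero p y" and "x < y" for x y
  proof -
    have "h x = 0" "h y = 0"
      using p_on_J(2) q_r_on_J(3) x y unfolding sign_changing_zero_def by auto
    have p0: "p t = 0" if t: "x < t" "t < y" for t
    proof -
      have tJ: "t \<in> J" using t x(1) y(1) by auto
      have "h t = 0"
        using h_monotone_on_J
      proof
        assume m: "mono_on J h"
        have "h x \<le> h t" "h t \<le> h y"
          using mono_onD[OF m] x(1) y(1) tJ t by auto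
        thus ?thesis using \<open>h x = 0\<close> \<open>h y = 0\<close> by simp
      next
        assume m: "antimono_on J h"
        have "h t \<le> h x" "h y \<le> h t"
          using monotone_onD[OF m] x(1) y(1) tJ t by auto
        thus ?thesis using \<open>h x = 0\<close> \<open>h y = 0\<close> by simp
      qed
      thus ?thesis using p_on_J(2)[OF tJ] by simp
    qed
    obtain e where e: "e > 0"
      "\<And>y z. y \<in> {x - e<..<x + e} \<Longrightarrow> z \<in> {x - e<..<x + e} \<Longrightarrow> y < x \<Longrightarrow> x < z \<Longrightarrow> p y * p z < 0"
      using x(2) unfolding sign_changing_zero_def by blast
    \<comment> \<open>A point right of \<open>x\<close> that is close enough for the sign condition
      at \<open>x\<close> and still before \<open>y\<close>, where \<open>p\<close> vanishes. The
      left partner \<open>x - e / 2\<close> may lie outside \<open>J\<close>.\<close>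
    define t where "t = x + min e (y - x) / 2"
    have "x < t" "t < x + e" "t < y"
      using e(1) \<open>x < y\<close> by (auto simp: t_def min_def field_simps)
    hence "p (x - e / 2) * p t < 0" using e by auto
    thus False using p0[OF \<open>x < t\<close> \<open>t < y\<close>] by simp
  qed
  thus ?thesis
    unfolding Uniq_def by (metis linorder_neqE)
qed

end

end

section \<open>From the sorted grid to the theorem\<close>

lemma grid_intervals_avoid:
  assumes "a < b" "finite G" "G \<subseteq> {a<..<b}" "I \<in> grid_intervals a b (sorted_list_of_set G)"
  obtains u v where "I = {u<..<v}" "{u<..<v} \<subseteq> {a<..<b}" "{u<..<v} \<inter> G = {}"
proof -
  define L where "L = a # sorted_list_of_set G @ [b]"
  have set_L: "set L = insert a (insert b G)"
    using assms(2) by (auto simp: L_def)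
  have sorted: "sorted_wrt (<) L"
    using assms(1-3) by (auto simp: L_def sorted_wrt_append)
  obtain i where i: "I = {L ! i<..<L ! Suc i}" "Suc i < length L"
    using assms(4) unfolding grid_intervals_def Let_def L_def by auto
  have "{L ! i<..<L ! Suc i} \<inter> G = {}"
  proof (rule ccontr)
    assume "{L ! i<..<L ! Suc i} \<inter> G \<noteq> {}"
    then obtain x where "x \<in> {L ! i<..<L ! Suc i}" "x \<in> G"
      by blast
    hence x: "L ! i < x" "x < L ! Suc i" "x \<in> set L"
      using set_L by auto
    then obtain j where j: "j < length L" "x = L ! j"
      by (auto simp: in_set_conv_nth)
    \<comment> \<open>Sortedness turns comparison of entries into comparison of indices; no index
      lies strictly between \<open>i\<close> and \<open>Suc i\<close>.\<close>
    have "i < j"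
      using x(1) j i(2) sorted_wrt_nth_less[OF sorted, of j i] by (cases i j rule: linorder_cases) auto
    moreover have "j < Suc i"
      using x(2) j i(2) sorted_wrt_nth_less[OF sorted, of "Suc i" j]
      by (cases j "Suc i" rule: linorder_cases) auto
    ultimately show False by simp
  qed
  moreover have "L ! i \<in> {a..b}" "L ! Suc i \<in> {a..b}"
    using nth_mem[of i L] nth_mem[of "Suc i" L] i(2) set_L assms(1,3) by auto
  hence "{L ! i<..<L ! Suc i} \<subseteq> {a<..<b}" by auto
  ultimately show ?thesis using that i(1) by blast
qed

theorem mainTheorem1:
  fixes f :: "real \<Rightarrow> real" and a b :: real and n :: nat
    and \<psi> \<rho> :: "nat \<Rightarrow> real \<Rightarrow> real"
  assumes "a < b"
    and "f real_analytic_on {a..b}"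
    and "\<exists>x\<in>{a..b}. f x \<noteq> 0"
    and "GBF_sequence f a b n \<psi> \<rho>"
    and "\<forall>i\<in>{1..n}. \<exists>x\<in>{a..b}. \<rho> i x \<noteq> 0"
  shows "(\<exists>c. \<forall>x\<in>{a..b}. \<psi> (n - 1) x = c * \<rho> n x) \<and>
    (\<forall>k\<in>{1..n}.
       finite (GBF_grid a b (\<psi> k) (\<rho> k)) \<and>
       simple_grid (\<psi> (k - 1)) a b (sorted_list_of_set (GBF_grid a b (\<psi> k) (\<rho> k))) \<and>
       (\<forall>I\<in>grid_intervals a b (sorted_list_of_set (GBF_grid a b (\<psi> k) (\<rho> k))).
          (mono_on I (mero_quotient {a..b} (\<psi> (k - 1)) (\<rho> k)) \<or>
           antimono_on I (mero_quotient {a..b} (\<psi> (k - 1)) (\<rho> k))) \<and>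
          (\<forall>x\<in>I. \<not> is_pole (\<psi> (k - 1)) x) \<and>
          (\<exists>\<^sub>\<le>\<^sub>1 x. x \<in> I \<and> sign_changing_zero (\<psi> (k - 1)) x)))"
proof -
  note GBF = assms(4)[unfolded GBF_sequence_def]
  have \<psi>0: "\<forall>x\<in>{a..b}. \<psi> 0 x = f x" and \<psi>n: "\<forall>x\<in>{a..b}. \<psi> n x = 0"
    and quot: "\<And>i. i \<in> {1..n} \<Longrightarrow> analytic_quotient_on (\<psi> i) a b"
      "\<And>i. i \<in> {1..n} \<Longrightarrow> analytic_quotient_on (\<rho> i) a b"
    using GBF by blast+
  \<comment> \<open>For \<open>n = 0\<close> the function \<open>\<psi> 0\<close> would be both
    \<open>f\<close> and zero. This makes \<open>n\<close> a legitimate index of a pivot and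
    \<open>n - 1\<close> a true predecessor.\<close>
  have n: "n \<ge> 1"
  proof (rule ccontr)
    assume "\<not> n \<ge> 1"
    hence "n = 0" by simp
    thus False using \<psi>0 \<psi>n assms(3) by auto
  qed
  have nice_f: "nicely_mero_within f x {a..b}" if "x \<in> {a..b}" for x
    by (rule real_analytic_on_imp_nicely_mero[OF assms(2) that at_within_Icc_neq_bot[OF assms(1) that]])
  \<comment> \<open>The quotient condition starts at index 1; regularity of \<open>\<psi> 0\<close>
    comes from the analyticity of \<open>f\<close>.\<close>
  have \<psi>_nice: "nicely_mero_within (\<psi> i) x {a..b}" if "i \<le> n" "x \<in> {a..b}" for i x
  proof (cases "i = 0")
    case True
    have "nicely_mero_within (\<psi> 0) x {a..b}"
      by (rule nicely_mero_within_cong[OF _ that(2) nice_f[OF that(2)]]) (use \<psi>0 in auto)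
    thus ?thesis using True by simp
  next
    case False
    hence "i \<in> {1..n}" using that(1) by simp
    from analytic_quotient_on_imp_nicely_mero[OF assms(1) quot(1)[OF this] that(2)]
    show ?thesis .
  qed
  have \<rho>_nice: "nicely_mero_within (\<rho> i) x {a..b}" if "i \<in> {1..n}" "x \<in> {a..b}" for i x
    by (rule analytic_quotient_on_imp_nicely_mero[OF assms(1) quot(2)[OF that(1)] that(2)])
  have step: "GBF_step a b (\<psi> (k - 1)) (\<psi> k) (\<rho> k)" if k: "k \<in> {1..n}" for k
  proof (rule GBF_step.intro[OF assms(1)])
    show "nicely_mero_within (\<psi> (k - 1)) x {a..b}" "nicely_mero_within (\<psi> k) x {a..b}"
      "nicely_mero_within (\<rho> k) x {a..b}" if "x \<in> {a..b}" for x
      using \<psi>_nice[of "k - 1" x] \<psi>_nice[of k x] \<rho>_nice[of k x] k that by auto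
    show "\<exists>x\<in>{a..b}. \<rho> k x \<noteq> 0" using assms(5) k by blast
    fix x assume "x \<in> {a..b}"
      "\<not> pole_within (mero_quotient {a..b} (\<psi> (k - 1)) (\<rho> k)) x {a..b}"
      "\<not> pole_within (mero_quotient {a..b} (\<psi> k) (\<rho> k)) x {a..b}"
    thus "(mero_quotient {a..b} (\<psi> (k - 1)) (\<rho> k) has_real_derivative
        mero_quotient {a..b} (\<psi> k) (\<rho> k) x) (at x within {a..b})"
      using GBF k by blast
  qed
  have "\<exists>c. \<forall>x\<in>{a..b}. \<psi> (n - 1) x = c * \<rho> n x"
    using GBF_step.p_eq_const_times_r[OF step[of n] \<psi>n] n by simp
  moreover have "finite (GBF_grid a b (\<psi> k) (\<rho> k)) \<and>
       simple_grid (\<psi> (k - 1)) a b (sorted_list_of_set (GBF_grid a b (\<psi> k) (\<rho> k))) \<and>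
       (\<forall>I\<in>grid_intervals a b (sorted_list_of_set (GBF_grid a b (\<psi> k) (\<rho> k))).
          (mono_on I (mero_quotient {a..b} (\<psi> (k - 1)) (\<rho> k)) \<or>
           antimono_on I (mero_quotient {a..b} (\<psi> (k - 1)) (\<rho> k))) \<and>
          (\<forall>x\<in>I. \<not> is_pole (\<psi> (k - 1)) x) \<and>
          (\<exists>\<^sub>\<le>\<^sub>1 x. x \<in> I \<and> sign_changing_zero (\<psi> (k - 1)) x))"
    if k: "k \<in> {1..n}" for k
  proof -
    interpret GBF_step a b "\<psi> (k - 1)" "\<psi> k" "\<rho> k" by (rule step[OF k])
    define G where "G = GBF_grid a b (\<psi> k) (\<rho> k)"
    have fin: "finite G" unfolding G_def by (rule finite_grid)
    have sub: "G \<subseteq> {a<..<b}" unfolding G_def GBF_grid_def by auto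
    have *: "(mono_on I h \<or> antimono_on I h) \<and> (\<forall>x\<in>I. \<not> is_pole (\<psi> (k - 1)) x) \<and>
        (\<exists>\<^sub>\<le>\<^sub>1 x. x \<in> I \<and> sign_changing_zero (\<psi> (k - 1)) x)"
      if I: "I \<in> grid_intervals a b (sorted_list_of_set G)" for I
    proof -
      obtain u v where I: "I = {u<..<v}" "{u<..<v} \<subseteq> {a<..<b}" "{u<..<v} \<inter> G = {}"
        using grid_intervals_avoid[OF assms(1) fin sub I] .
      note uv = I(2) I(3)[unfolded G_def]
      show ?thesis
        unfolding I(1)
        using h_monotone_on_J[OF uv] p_on_J(1)[OF uv] p_sign_changing_zero_unique_on_J[OF uv] by blast
    qed
    have "sorted_wrt (<) (sorted_list_of_set G)" "set (sorted_list_of_set G) \<subseteq> {a..b}"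
      using fin sub by auto
    hence "simple_grid (\<psi> (k - 1)) a b (sorted_list_of_set G)"
      unfolding simple_grid_def simple_interval_def using * by blast
    thus ?thesis using fin * unfolding G_def by blast
  qed
  ultimately show ?thesis by blast
qed

end
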